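(* For every positive integer $k$, there is an $L>0$ such that \[\lim_{n\to\infty}\frac{\tilde{r}(P_k,P_n)}{n}=L=\lim_{n\to\infty}\frac{\tilde{r}(P_k,C_n)}{n}.\]
   Context: For graphs $G$ and $H$, the online Ramsey game is played by Builder and Painter on the infinite complete graph $K_{\mathbb{N}}$ with vertex set $\mathbb{N}$. In each round Builder chooses an edge of $K_{\mathbb{N}}$ and Painter immediately and irrevocably colors it red or blue. (Builder is allowed to choose a previously chosen edge; this does not make Builder any stronger.) The online Ramsey number $\tilde{r}(G,H)$ is the smallest integer $t$ for which Builder has a strategy that guarantees a red copy of $G$ or a blue copy of $H$ in at most $t$ rounds, regardless of the choices that Painter makes. $P_n$ denotes the path on $n$ vertices and $C_n$ the cycle on $n$ vertices.
   Formalization: The claim L > 0 is made only for k ≥ 2: for k = 1 a red P_1 is present before any round, so the online Ramsey numbers are 0 and both limits equal 0; existence and equality of the limits are kept for every k ≥ 1. *)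

theory Defs
  imports Complex_Main
begin

type_synonym 'v ugraph = "'v set \<times> 'v set set"

definition path_graph :: "nat \<Rightarrow> nat ugraph" where
  "path_graph n = ({..<n}, {{i, i + 1} |i. i + 1 < n})"

text \<open>The cycle on \<open>n\<close> vertices; this is a simple graph, and the intended one, only for \<open>n \<ge> 3\<close>.\<close>

definition cycle_graph :: "nat \<Rightarrow> nat ugraph" where
  "cycle_graph n = ({..<n}, {{i, (i + 1) mod n} |i. i < n})"

text \<open>\<open>F\<close> is a set of edges of the complete graph on the natural numbers. Copies are subgraphs,
  not necessarily induced, and all natural numbers are available as vertices.\<close>

definition contains_copy :: "'v ugraph \<Rightarrow> nat set set \<Rightarrow> bool" where
  "contains_copy G F \<longleftrightarrow> (\<exists>f. inj_on f (fst G) \<and> (\<forall>e \<in> snd G. f ` e \<in> F))"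

definition edges_KN :: "nat set set" where
  "edges_KN = {{u, v} |u v. u \<noteq> v}"

datatype colour = Red | Blue

text \<open>The rounds played so far, in chronological order.\<close>

type_synonym history = "(nat set \<times> colour) list"

type_synonym builder = "history \<Rightarrow> nat set"

type_synonym painter = "history \<Rightarrow> nat set \<Rightarrow> colour"

definition builder_strategy :: "builder \<Rightarrow> bool" where
  "builder_strategy \<sigma> \<longleftrightarrow> (\<forall>h. \<sigma> h \<in> edges_KN)"

text \<open>Colours are irrevocable: an edge that Builder chooses again keeps its colour, and
  Painter's answer is ignored in that round.\<close>

definition round_colour :: "painter \<Rightarrow> history \<Rightarrow> nat set \<Rightarrow> colour" where
  "round_colour \<pi> h e = (case map_of h e of None \<Rightarrow> \<pi> h e | Some c \<Rightarrow> c)"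

primrec play :: "builder \<Rightarrow> painter \<Rightarrow> nat \<Rightarrow> history" where
  "play \<sigma> \<pi> 0 = []"
| "play \<sigma> \<pi> (Suc t) =
     (let h = play \<sigma> \<pi> t; e = \<sigma> h in h @ [(e, round_colour \<pi> h e)])"

definition edges_of_colour :: "colour \<Rightarrow> history \<Rightarrow> nat set set" where
  "edges_of_colour c h = {e. (e, c) \<in> set h}"

definition builder_wins_within :: "'v ugraph \<Rightarrow> 'w ugraph \<Rightarrow> nat \<Rightarrow> bool" where
  "builder_wins_within G H t \<longleftrightarrow>
     (\<exists>\<sigma>. builder_strategy \<sigma> \<and>
       (\<forall>\<pi>. \<exists>s \<le> t.
          contains_copy G (edges_of_colour Red (play \<sigma> \<pi> s)) \<or>
          contains_copy H (edges_of_colour Blue (play \<sigma> \<pi> s))))"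

text \<open>For finite simple graphs the least element exists, by Ramsey's theorem.\<close>

definition online_ramsey :: "'v ugraph \<Rightarrow> 'w ugraph \<Rightarrow> nat" where
  "online_ramsey G H = (LEAST t. builder_wins_within G H t)"

end

theory Submission
  imports Defs "HOL-Library.Ramsey"
begin

text \<open>Write \<open>f n\<close> for the online Ramsey number of \<open>P\<^sub>k\<close> against \<open>P\<^sub>n\<close>. Everything rests on the fact that, as long
  as there is no red \<open>P\<^sub>k\<close>, Builder can repair blue structures at a cost that depends on \<open>k\<close> only.

  \<^item> A complete bipartite graph with \<open>k\<close> vertices on each side contains \<open>P\<^sub>k\<close>. Having built two
    disjoint blue paths on \<open>n\<close> and \<open>m\<close> vertices, Builder plays all \<open>k\<^sup>2\<close> edges between the last \<open>k\<close>
    vertices of one and the first \<open>k\<close> vertices of the other. One of them is blue, and after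
    discarding the ends beyond it a blue path on at least \<open>n + m - 2k\<close> vertices remains. Hence
    \<open>f (n + m - 2k) \<le> f n + f m + k\<^sup>2\<close> (\<open>online_ramsey_path_join\<close>), so that
    \<open>h n = f (n + 2k) + k\<^sup>2\<close> is subadditive, and by Fekete's lemma \<open>h n / n\<close>, and with it
    \<open>f n / n\<close>, converges.

  \<^item> To close a blue path on \<open>n\<close> vertices to a cycle of exactly \<open>n + 2\<close> vertices, Builder first forces
    a blue clique on \<open>2k\<close> fresh vertices, which by Ramsey's theorem takes constantly many
    rounds. Each end of the path is then attached to one half of the clique as above. This discards
    at most \<open>2k - 2\<close> vertices of the path, and a detour of suitable length inside the clique replaces
    them (\<open>contains_cycle_through_clique\<close>). So for large \<open>n\<close> the numbers for
    cycles exceed those for paths by a bounded amount only; they are not smaller, because \<open>C\<^sub>n\<close> contains \<open>P\<^sub>n\<close>.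

  \<^item> For \<open>k \<ge> 2\<close> a Painter who always answers blue makes Builder pay for all \<open>n - 1\<close> edges of \<open>P\<^sub>n\<close>,
    so the limit is at least \<open>1\<close>.

  Strategies are handled through the predicate \<open>forces\<close>, a recursion over positions that is equivalent
  to the existence of a winning strategy (\<open>builder_wins_within_iff_forces\<close>) and that makes
  it easy to play one game after another.\<close>

section \<open>The game as a recursion over positions\<close>

text \<open>\<open>forces Q t R B\<close>: with red edges \<open>R\<close> and blue edges \<open>B\<close> on the board, Builder can reach a position
  satisfying \<open>Q\<close> within \<open>t\<close> rounds. Painter is even allowed to give an edge that is already on the
  board the other colour as well. This changes nothing: a repeated edge need only be answered with
  its old colour, after which Builder has merely lost a round. In exchange, strategies can be
  combined without keeping track of which edges have been played.\<close>

primrec forces :: "(nat set set \<Rightarrow> nat set set \<Rightarrow> bool) \<Rightarrow> nat \<Rightarrow> nat set set \<Rightarrow> nat set set \<Rightarrow> bool" where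
  "forces Q 0 R B = Q R B"
| "forces Q (Suc t) R B =
     (Q R B \<or> (\<exists>e \<in> edges_KN. forces Q t (insert e R) B \<and> forces Q t R (insert e B)))"

lemma forces_now: "Q R B \<Longrightarrow> forces Q t R B"
  by (cases t) auto

lemma forces_Suc: "forces Q t R B \<Longrightarrow> forces Q (Suc t) R B"
proof (induction t arbitrary: R B)
  case (Suc t)
  from Suc.prems consider "Q R B" | e where "e \<in> edges_KN"
      "forces Q t (insert e R) B" "forces Q t R (insert e B)" by auto
  then show ?case
  proof cases
    case 1
    then show ?thesis by (rule forces_now)
  next
    case 2
    then have "forces Q (Suc t) (insert e R) B" "forces Q (Suc t) R (insert e B)"
      using Suc.IH by blast+
    then show ?thesis using 2(1) forces.simps(2) by blast
  qed
qed simp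

lemma forces_mono_rounds: "s \<le> t \<Longrightarrow> forces Q s R B \<Longrightarrow> forces Q t R B"
  by (induction t rule: dec_induct) (auto simp del: forces.simps intro: forces_Suc)

lemma edges_of_colour_append:
  "edges_of_colour c (h @ [(e, d)]) =
     (if c = d then insert e (edges_of_colour c h) else edges_of_colour c h)"
  by (auto simp: edges_of_colour_def)

lemma length_play: "length (play \<sigma> \<pi> t) = t"
  by (induction t) (auto simp: Let_def)

definition target :: "'v ugraph \<Rightarrow> 'w ugraph \<Rightarrow> nat set set \<Rightarrow> nat set set \<Rightarrow> bool" where
  "target G H R B \<longleftrightarrow> contains_copy G R \<or> contains_copy H B"

abbreviation reds :: "history \<Rightarrow> nat set set" where
  "reds \<equiv> edges_of_colour Red"

abbreviation blues :: "history \<Rightarrow> nat set set" where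
  "blues \<equiv> edges_of_colour Blue"

text \<open>Builder always picks an edge after which both answers leave a position that is won within the
  remaining rounds; how many rounds remain can be read off the length of the history.\<close>

lemma forces_imp_builder_strategy:
  assumes "forces Q t {} {}"
  shows "\<exists>\<sigma>. builder_strategy \<sigma> \<and> (\<forall>\<pi>. \<exists>s \<le> t. Q (reds (play \<sigma> \<pi> s)) (blues (play \<sigma> \<pi> s)))"
proof -
  define good where "good h e \<longleftrightarrow> e \<in> edges_KN \<and>
      forces Q (t - Suc (length h)) (insert e (reds h)) (blues h) \<and>
      forces Q (t - Suc (length h)) (reds h) (insert e (blues h))" for h e
  define \<sigma> where "\<sigma> h = (if \<exists>e. good h e then SOME e. good h e else {0, 1})" for h
  have good_\<sigma>: "good h (\<sigma> h)" if "\<exists>e. good h e" for h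
    using that someI_ex[OF that] unfolding \<sigma>_def by simp
  have "{0, 1 :: nat} \<in> edges_KN"
    unfolding edges_KN_def by (metis (mono_tags, lifting) mem_Collect_eq zero_neq_one)
  then have strat: "builder_strategy \<sigma>"
    unfolding builder_strategy_def
    by (metis \<sigma>_def good_\<sigma> good_def)
  have "\<exists>s \<le> t. Q (reds (play \<sigma> \<pi> s)) (blues (play \<sigma> \<pi> s))" for \<pi>
  proof (rule ccontr)
    assume neg: "\<not> ?thesis"
    have inv: "forces Q (t - s) (reds (play \<sigma> \<pi> s)) (blues (play \<sigma> \<pi> s))" if "s \<le> t" for s
      using that
    proof (induction s)
      case 0
      then show ?case using assms by (simp add: edges_of_colour_def)
    next
      case (Suc s)
      let ?h = "play \<sigma> \<pi> s"
      have "t - s = Suc (t - Suc s)" using Suc.prems by simp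
      with Suc have "forces Q (Suc (t - Suc s)) (reds ?h) (blues ?h)" by simp
      moreover have "\<not> Q (reds ?h) (blues ?h)" using neg Suc.prems by auto
      ultimately have "\<exists>e. good ?h e"
        by (auto simp: good_def length_play)
      then have "good ?h (\<sigma> ?h)" by (rule good_\<sigma>)
      then show ?case
        by (cases "round_colour \<pi> ?h (\<sigma> ?h)")
          (auto simp: good_def length_play Let_def edges_of_colour_append)
    qed
    from inv[of t] neg show False by auto
  qed
  with strat show ?thesis by blast
qed

text \<open>If the position is not won by \<open>forces\<close>, Painter survives by always moving to a position that is
  not won within the remaining rounds.\<close>

lemma builder_strategy_imp_forces:
  assumes "builder_strategy \<sigma>"
    and win: "\<And>\<pi>. \<exists>s \<le> t. Q (reds (play \<sigma> \<pi> s)) (blues (play \<sigma> \<pi> s))"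
  shows "forces Q t {} {}"
proof (rule ccontr)
  assume neg: "\<not> ?thesis"
  define \<pi> where "\<pi> h e =
    (if forces Q (t - Suc (length h)) (insert e (reds h)) (blues h) then Blue else Red)" for h e
  have inv: "\<not> forces Q (t - s) (reds (play \<sigma> \<pi> s)) (blues (play \<sigma> \<pi> s))" if "s \<le> t" for s
    using that
  proof (induction s)
    case 0
    then show ?case using neg by (simp add: edges_of_colour_def)
  next
    case (Suc s)
    let ?h = "play \<sigma> \<pi> s" and ?u = "t - Suc s"
    let ?e = "\<sigma> ?h"
    have "t - s = Suc ?u" using Suc.prems by simp
    with Suc have nf: "\<not> forces Q (Suc ?u) (reds ?h) (blues ?h)" by simp
    have e: "?e \<in> edges_KN" using assms(1) by (simp add: builder_strategy_def)
    show ?case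
    proof (cases "map_of ?h ?e")
      case None
      moreover have "\<pi> ?h ?e = (if forces Q ?u (insert ?e (reds ?h)) (blues ?h) then Blue else Red)"
        by (simp only: \<pi>_def length_play)
      ultimately have "round_colour \<pi> ?h ?e =
          (if forces Q ?u (insert ?e (reds ?h)) (blues ?h) then Blue else Red)"
        by (simp add: round_colour_def)
      then show ?thesis using nf e
        by (auto simp: Let_def edges_of_colour_append)
    next
      case (Some c)
      \<comment> \<open>A repeated edge leaves the position unchanged, so it only costs Builder a round.\<close>
      then have "?e \<in> edges_of_colour c ?h"
        by (auto simp: edges_of_colour_def dest: map_of_SomeD)
      with Some have "reds (play \<sigma> \<pi> (Suc s)) = reds ?h" "blues (play \<sigma> \<pi> (Suc s)) = blues ?h"
        by (auto simp: Let_def edges_of_colour_append round_colour_def)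
      then show ?thesis using nf forces_Suc by metis
    qed
  qed
  from win[of \<pi>] obtain s where "s \<le> t" "Q (reds (play \<sigma> \<pi> s)) (blues (play \<sigma> \<pi> s))" by blast
  with inv[of s] forces_now show False by metis
qed

lemma builder_wins_within_iff_forces:
  "builder_wins_within G H t \<longleftrightarrow> forces (target G H) t {} {}"
proof
  assume "builder_wins_within G H t"
  then obtain \<sigma> where "builder_strategy \<sigma>"
    "\<And>\<pi>. \<exists>s \<le> t. target G H (reds (play \<sigma> \<pi> s)) (blues (play \<sigma> \<pi> s))"
    unfolding builder_wins_within_def target_def by metis
  then show "forces (target G H) t {} {}" by (rule builder_strategy_imp_forces)
next
  assume "forces (target G H) t {} {}"
  from forces_imp_builder_strategy[OF this] show "builder_wins_within G H t"
    by (simp add: builder_wins_within_def target_def)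
qed

lemma online_ramsey_le: "forces (target G H) t {} {} \<Longrightarrow> online_ramsey G H \<le> t"
  unfolding online_ramsey_def builder_wins_within_iff_forces by (rule Least_le)

lemma forces_online_ramsey:
  "forces (target G H) t {} {} \<Longrightarrow> forces (target G H) (online_ramsey G H) {} {}"
  unfolding online_ramsey_def builder_wins_within_iff_forces by (rule LeastI)

section \<open>Combining strategies\<close>

lemma forces_then:
  assumes "forces P s R B"
    and "\<And>R' B'. R \<subseteq> R' \<Longrightarrow> B \<subseteq> B' \<Longrightarrow> P R' B' \<Longrightarrow> forces Q t R' B'"
  shows "forces Q (s + t) R B"
  using assms
proof (induction s arbitrary: R B)
  case (Suc s)
  from Suc.prems(1) consider "P R B" | e where "e \<in> edges_KN"
      "forces P s (insert e R) B" "forces P s R (insert e B)" by auto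
  then show ?case
  proof cases
    case 1
    then have "forces Q t R B" using Suc.prems(2) by blast
    then show ?thesis by (rule forces_mono_rounds[rotated]) simp
  next
    case 2
    have "forces Q (s + t) (insert e R) B"
      by (rule Suc.IH[OF 2(2)]) (rule Suc.prems(2), auto)
    moreover have "forces Q (s + t) R (insert e B)"
      by (rule Suc.IH[OF 2(3)]) (rule Suc.prems(2), auto)
    ultimately show ?thesis using 2(1) by auto
  qed
qed auto

lemma forces_weaken:
  assumes "forces P t R B"
    and "\<And>R' B'. R \<subseteq> R' \<Longrightarrow> B \<subseteq> B' \<Longrightarrow> P R' B' \<Longrightarrow> Q R' B'"
  shows "forces Q t R B"
  using forces_then[of P t R B Q 0] assms by auto

text \<open>This is how a game is restarted after another one: the old edges \<open>R0\<close> and \<open>B0\<close> stay on the board,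
  and \<open>\<phi>\<close> moves the new game to vertices that are disjoint from the paths built before.\<close>

lemma forces_relabel:
  assumes "forces P t R B" "inj \<phi>"
    and "\<And>R1 B1. P R1 B1 \<Longrightarrow> Q (R0 \<union> image \<phi> ` R1) (B0 \<union> image \<phi> ` B1)"
  shows "forces Q t (R0 \<union> image \<phi> ` R) (B0 \<union> image \<phi> ` B)"
  using assms(1)
proof (induction t arbitrary: R B)
  case 0
  then show ?case using assms(3) by simp
next
  case (Suc t)
  from Suc.prems consider "P R B" | e where "e \<in> edges_KN"
      "forces P t (insert e R) B" "forces P t R (insert e B)" by auto
  then show ?case
  proof cases
    case 1
    then show ?thesis using assms(3) forces_now by blast
  next
    case 2
    have "\<phi> ` e \<in> edges_KN"
      using 2(1) \<open>inj \<phi>\<close> by (fastforce simp: edges_KN_def dest: injD)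
    then show ?thesis
      using Suc.IH[OF 2(2)] Suc.IH[OF 2(3)] by auto
  qed
qed

lemma forces_colouring:
  assumes "finite E" "E \<subseteq> edges_KN"
  shows "forces (\<lambda>R' B'. E \<subseteq> R' \<union> B') (card E) R B"
proof -
  \<comment> \<open>\<open>D\<close> collects the edges asked so far, so that the induction remembers their colours.\<close>
  have "forces (\<lambda>R' B'. D \<union> E \<subseteq> R' \<union> B') (card E) R B" if "D \<subseteq> R \<union> B" for D
    using assms that
  proof (induction E arbitrary: D R B)
    case (insert e E)
    have E: "E \<subseteq> edges_KN" and e: "e \<in> edges_KN" using insert.prems by auto
    have "insert e D \<subseteq> insert e R \<union> B" "insert e D \<subseteq> R \<union> insert e B"
      using insert.prems by auto
    from insert.IH[OF E this(1)] insert.IH[OF E this(2)]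
    have "forces (\<lambda>R' B'. insert e D \<union> E \<subseteq> R' \<union> B') (Suc (card E)) R B"
      using e by (simp only: forces.simps) blast
    then show ?case using insert.hyps by simp
  qed simp
  from this[of "{}"] show ?thesis by simp
qed

section \<open>Paths as vertex lists\<close>

definition is_path :: "nat set set \<Rightarrow> nat list \<Rightarrow> bool" where
  "is_path F xs \<longleftrightarrow> distinct xs \<and> successively (\<lambda>u v. {u, v} \<in> F) xs"

lemma contains_path_iff: "contains_copy (path_graph n) F \<longleftrightarrow> (\<exists>xs. length xs = n \<and> is_path F xs)"
proof
  assume "contains_copy (path_graph n) F"
  then obtain f where inj: "inj_on f {..<n}" and edges: "\<forall>e \<in> snd (path_graph n). f ` e \<in> F"
    by (auto simp: contains_copy_def path_graph_def)
  have "f ` {i, i + 1} \<in> F" if "i + 1 < n" for i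
    by (rule edges[rule_format]) (use that in \<open>auto simp: path_graph_def\<close>)
  with inj have f: "inj_on f {..<n}" "\<And>i. i + 1 < n \<Longrightarrow> f ` {i, i + 1} \<in> F" by blast+
  have "is_path F (map f [0..<n])"
    using f by (auto simp: is_path_def distinct_map successively_conv_nth lessThan_atLeast0)
  then show "\<exists>xs. length xs = n \<and> is_path F xs"
    by (intro exI[of _ "map f [0..<n]"]) simp
next
  assume "\<exists>xs. length xs = n \<and> is_path F xs"
  then obtain xs where xs: "length xs = n" "is_path F xs" by blast
  have "inj_on ((!) xs) {..<n}"
    using xs by (auto simp: is_path_def inj_on_def nth_eq_iff_index_eq)
  moreover have "(!) xs ` {i, i + 1} \<in> F" if "i + 1 < n" for i
    using that xs by (auto simp: is_path_def successively_conv_nth)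
  ultimately show "contains_copy (path_graph n) F"
    unfolding contains_copy_def path_graph_def by (intro exI[of _ "(!) xs"]) auto
qed

lemma contains_cycleI:
  assumes "is_path F xs" "length xs = n" "xs \<noteq> []" "{last xs, hd xs} \<in> F"
  shows "contains_copy (cycle_graph n) F"
proof -
  have "inj_on ((!) xs) {..<n}"
    using assms by (auto simp: is_path_def inj_on_def nth_eq_iff_index_eq)
  moreover have "(!) xs ` {i, (i + 1) mod n} \<in> F" if "i < n" for i
  proof (cases "i + 1 = n")
    case True
    then have "xs ! i = last xs" "xs ! 0 = hd xs"
      using assms by (auto simp: last_conv_nth hd_conv_nth)
    then show ?thesis using True assms(4) by simp
  next
    case False
    then show ?thesis using that assms by (auto simp: is_path_def successively_conv_nth)
  qed
  ultimately show ?thesis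
    unfolding contains_copy_def cycle_graph_def by (intro exI[of _ "(!) xs"]) auto
qed

lemma cycle_contains_path:
  assumes "contains_copy (cycle_graph n) F"
  shows "contains_copy (path_graph n) F"
proof -
  have "snd (path_graph n) \<subseteq> snd (cycle_graph n)"
    by (fastforce simp: path_graph_def cycle_graph_def)
  moreover have "fst (path_graph n) = fst (cycle_graph n)"
    by (simp add: path_graph_def cycle_graph_def)
  ultimately show ?thesis
    using assms unfolding contains_copy_def by (metis subsetD)
qed

lemma is_path_mono: "is_path F xs \<Longrightarrow> F \<subseteq> F' \<Longrightarrow> is_path F' xs"
  by (auto simp: is_path_def intro: successively_mono)

lemma is_path_append_iff:
  "is_path F (xs @ ys) \<longleftrightarrow> is_path F xs \<and> is_path F ys \<and> set xs \<inter> set ys = {} \<and>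
     (xs = [] \<or> ys = [] \<or> {last xs, hd ys} \<in> F)"
  by (auto simp: is_path_def successively_append_iff)

lemma contains_path_of_long_path:
  assumes "is_path F xs" "n \<le> length xs"
  shows "contains_copy (path_graph n) F"
proof -
  have "is_path F (take n xs)"
    using assms(1) is_path_append_iff[of F "take n xs" "drop n xs"] by simp
  then show ?thesis unfolding contains_path_iff using assms(2) by (intro exI[of _ "take n xs"]) simp
qed

lemma is_path_relabel:
  assumes "is_path F xs" "inj \<phi>"
  shows "is_path (image \<phi> ` F) (map \<phi> xs)"
proof -
  have "{\<phi> u, \<phi> v} \<in> image \<phi> ` F" if "{u, v} \<in> F" for u v
    using that by (intro image_eqI[of _ _ "{u, v}"]) auto
  then show ?thesis
    using assms
    by (auto simp: is_path_def distinct_map successively_map intro: inj_on_subset successively_mono)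
qed

lemma is_path_in_clique:
  assumes "distinct xs" "set xs \<subseteq> K" "\<And>u v. u \<in> K \<Longrightarrow> v \<in> K \<Longrightarrow> u \<noteq> v \<Longrightarrow> {u, v} \<in> F"
  shows "is_path F xs"
  using assms by (auto simp: is_path_def successively_conv_nth nth_eq_iff_index_eq subset_iff)

text \<open>The path alternates between the two sides.\<close>

lemma contains_path_in_complete_bipartite:
  assumes "distinct xs" "distinct ys" "set xs \<inter> set ys = {}" "length xs = k" "length ys = k"
    and F: "\<And>u v. u \<in> set xs \<Longrightarrow> v \<in> set ys \<Longrightarrow> {u, v} \<in> F"
  shows "contains_copy (path_graph k) F"
proof -
  define f where "f i = (if even i then xs ! i else ys ! i)" for i
  have "inj_on f {0..<k}"
    using assms(1-5) unfolding inj_on_def f_def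
    by (auto simp: nth_eq_iff_index_eq disjoint_iff) (metis nth_mem)+
  moreover have "{f i, f (Suc i)} \<in> F" if "Suc i < k" for i
    using that assms(4,5) F[of "xs ! i" "ys ! Suc i"] F[of "xs ! Suc i" "ys ! i"]
    by (auto simp: f_def insert_commute)
  ultimately have "is_path F (map f [0..<k])"
    by (auto simp: is_path_def distinct_map successively_conv_nth)
  then show ?thesis unfolding contains_path_iff by (intro exI[of _ "map f [0..<k]"]) simp
qed

lemma path_length_le_card:
  assumes "contains_copy (path_graph n) F" "finite F"
  shows "n - 1 \<le> card F"
proof -
  obtain xs where xs: "length xs = n" "is_path F xs" using assms(1) contains_path_iff by blast
  let ?e = "\<lambda>i. {xs ! i, xs ! Suc i}"
  have "inj_on ?e {..<n - 1}"
    using xs by (auto simp: inj_on_def is_path_def doubleton_eq_iff nth_eq_iff_index_eq)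
  moreover have "?e ` {..<n - 1} \<subseteq> F"
    using xs by (auto simp: is_path_def successively_conv_nth)
  ultimately show ?thesis using card_inj_on_le[of ?e "{..<n - 1}" F] assms(2) by simp
qed


lemma is_path_take: "is_path F xs \<Longrightarrow> is_path F (take i xs)"
  and is_path_drop: "is_path F xs \<Longrightarrow> is_path F (drop i xs)"
  using is_path_append_iff[of F "take i xs" "drop i xs"] by simp_all

section \<open>Joining blue paths\<close>

lemma doubleton_in_edges_KN: "{u, v} \<in> edges_KN \<longleftrightarrow> u \<noteq> v"
  by (auto simp: edges_KN_def doubleton_eq_iff)

text \<open>The basic repair step: if all the edges between the two sides are red, they contain a red \<open>P\<^sub>k\<close>.\<close>

lemma forces_blue_edge_between:
  assumes "distinct xs" "distinct ys" "set xs \<inter> set ys = {}" "length xs = k" "length ys = k"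
  shows "forces (\<lambda>R' B'. contains_copy (path_graph k) R' \<or>
    (\<exists>x \<in> set xs. \<exists>y \<in> set ys. {x, y} \<in> B')) (k * k) R B"
proof -
  define E where "E = (\<lambda>(x, y). {x, y}) ` (set xs \<times> set ys)"
  have E: "E \<subseteq> edges_KN" "finite E"
    using assms(3) by (auto simp: E_def doubleton_in_edges_KN)
  have "card E \<le> card (set xs \<times> set ys)" unfolding E_def by (rule card_image_le) simp
  also have "\<dots> = k * k" using assms by (simp add: card_cartesian_product distinct_card)
  finally have "forces (\<lambda>R' B'. E \<subseteq> R' \<union> B') (k * k) R B"
    using forces_colouring[OF E(2,1)] forces_mono_rounds by blast
  then show ?thesis
  proof (rule forces_weaken)
    fix R' B' assume col: "E \<subseteq> R' \<union> B'"
    show "contains_copy (path_graph k) R' \<or> (\<exists>x \<in> set xs. \<exists>y \<in> set ys. {x, y} \<in> B')"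
    proof (rule disjCI)
      assume "\<not> (\<exists>x \<in> set xs. \<exists>y \<in> set ys. {x, y} \<in> B')"
      then have "{u, v} \<in> R'" if "u \<in> set xs" "v \<in> set ys" for u v
        using that col by (fastforce simp: E_def)
      with assms show "contains_copy (path_graph k) R'"
        by (rule contains_path_in_complete_bipartite)
    qed
  qed
qed

lemma forces_joined_path:
  assumes xs: "is_path B xs" "k \<le> length xs" and ys: "is_path B ys" "k \<le> length ys"
    and disj: "set xs \<inter> set ys = {}"
  shows "forces (target (path_graph k) (path_graph (length xs + length ys - 2 * k))) (k * k) R B"
proof -
  \<comment> \<open>The new edge joins the last \<open>k\<close> vertices of \<open>xs\<close> to the first \<open>k\<close> vertices of \<open>ys\<close>, so that at
    most \<open>k - 1\<close> vertices of each path lie beyond it.\<close>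
  let ?xs = "drop (length xs - k) xs" and ?ys = "take k ys"
  have "forces (\<lambda>R' B'. contains_copy (path_graph k) R' \<or>
      (\<exists>x \<in> set ?xs. \<exists>y \<in> set ?ys. {x, y} \<in> B')) (k * k) R B"
    using assms by (intro forces_blue_edge_between)
      (auto simp: is_path_def dest: in_set_takeD in_set_dropD)
  then show ?thesis
  proof (rule forces_weaken)
    fix R' B'
    assume "B \<subseteq> B'"
      and "contains_copy (path_graph k) R' \<or> (\<exists>x \<in> set ?xs. \<exists>y \<in> set ?ys. {x, y} \<in> B')"
    then consider "contains_copy (path_graph k) R'"
      | x y where "x \<in> set ?xs" "y \<in> set ?ys" "{x, y} \<in> B'" by blast
    then show "target (path_graph k) (path_graph (length xs + length ys - 2 * k)) R' B'"
    proof cases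
      case 2
      obtain i' where i': "i' < k" "x = xs ! (length xs - k + i')"
        using 2(1) xs(2) by (auto simp: in_set_conv_nth)
      define i where "i = length xs - k + i'"
      obtain j where j: "j < k" "y = ys ! j"
        using 2(2) ys(2) by (auto simp: in_set_conv_nth)
      have i: "i < length xs" "length xs \<le> i + k" "x = xs ! i"
        using i' xs(2) by (auto simp: i_def)
      let ?zs = "take (Suc i) xs @ drop j ys"
      have "last (take (Suc i) xs) = x" "hd (drop j ys) = y"
        using i j ys(2) by (auto simp: take_Suc_conv_app_nth hd_drop_conv_nth)
      then have "is_path B' ?zs"
        using xs ys disj 2(3) is_path_mono[OF _ \<open>B \<subseteq> B'\<close>]
        by (auto simp: is_path_append_iff is_path_take is_path_drop
            dest: in_set_takeD in_set_dropD)
      moreover have "length xs + length ys - 2 * k \<le> length ?zs"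
        using i j ys(2) by auto
      ultimately show ?thesis
        by (simp add: target_def contains_path_of_long_path del: length_append)
    qed (simp add: target_def)
  qed
qed

text \<open>By Ramsey's theorem it suffices to ask for all edges on a large set: a red clique on \<open>k\<close>
  vertices contains a red \<open>P\<^sub>k\<close>. The number of rounds must not depend on the lower bound \<open>a\<close> for the
  vertices, since \<open>a\<close> serves to avoid the vertices of a long path.\<close>

lemma forces_blue_clique:
  "\<exists>t. \<forall>a R B. forces (\<lambda>R' B'. contains_copy (path_graph k) R' \<or>
     (\<exists>ks. length ks = n \<and> distinct ks \<and> set ks \<subseteq> {a..} \<and> clique (set ks) B')) t R B"
proof -
  obtain r where r: "\<And>(V::nat set) E. finite V \<Longrightarrow> r \<le> card V \<Longrightarrow>
      \<exists>K \<subseteq> V. card K = k \<and> clique K E \<or> card K = n \<and> indep K E"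
    using ramsey2[of k n] by metis
  have "forces (\<lambda>R' B'. contains_copy (path_graph k) R' \<or>
     (\<exists>ks. length ks = n \<and> distinct ks \<and> set ks \<subseteq> {a..} \<and> clique (set ks) B')) (r * r) R B"
    for a R B
  proof -
    define V where "V = {a..<a + r}"
    define E where "E = {{u, v} |u v. u \<in> V \<and> v \<in> V \<and> u \<noteq> v}"
    have sub: "E \<subseteq> (\<lambda>(u, v). {u, v}) ` (V \<times> V)"
      by (auto simp: E_def)
    have E: "E \<subseteq> edges_KN" by (auto simp: E_def doubleton_in_edges_KN)
    have fin: "finite ((\<lambda>(u, v). {u, v}) ` (V \<times> V))" by (simp add: V_def)
    have "card E \<le> card (V \<times> V)"
      using card_mono[OF fin sub] card_image_le[of "V \<times> V" "\<lambda>(u, v). {u, v}"]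
      by (simp add: V_def)
    then have "card E \<le> r * r" by (simp add: card_cartesian_product V_def)
    then have "forces (\<lambda>R' B'. E \<subseteq> R' \<union> B') (r * r) R B"
      using forces_colouring[OF finite_subset[OF sub fin] E] forces_mono_rounds by blast
    then show ?thesis
    proof (rule forces_weaken)
      fix R' B' assume col: "E \<subseteq> R' \<union> B'"
      obtain K where K: "K \<subseteq> V" "card K = k \<and> clique K R' \<or> card K = n \<and> indep K R'"
        using r[of V R'] by (auto simp: V_def)
      have "finite K" using K(1) by (rule finite_subset) (simp add: V_def)
      then obtain ks where ks: "set ks = K" "distinct ks" "length ks = card K"
        using finite_distinct_list distinct_card by metis
      from K(2) show "contains_copy (path_graph k) R' \<or>
        (\<exists>ks. length ks = n \<and> distinct ks \<and> set ks \<subseteq> {a..} \<and> clique (set ks) B')"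
      proof
        assume "card K = k \<and> clique K R'"
        moreover from this ks have "is_path R' ks"
          by (intro is_path_in_clique[of ks K]) (auto simp: clique_def)
        ultimately show ?thesis
          using ks contains_path_of_long_path[of R' ks k] by simp
      next
        assume *: "card K = n \<and> indep K R'"
        have "{u, v} \<in> B'" if "u \<in> K" "v \<in> K" "u \<noteq> v" for u v
        proof -
          have "{u, v} \<in> E" using that K(1) unfolding E_def by blast
          moreover have "{u, v} \<notin> R'" using that * by (simp add: indep_def)
          ultimately show ?thesis using col by blast
        qed
        then have "clique (set ks) B'" using ks by (simp add: clique_def)
        moreover have "set ks \<subseteq> {a..}" using ks K(1) by (auto simp: V_def)
        ultimately show ?thesis using ks * by blast
      qed
    qed
  qed
  then show ?thesis by blast
qed

text \<open>A blue clique contains a blue path, so Builder wins within some number of rounds and the least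
  such number is attained.\<close>

lemma forces_path_online_ramsey:
  "forces (target (path_graph k) (path_graph n)) (online_ramsey (path_graph k) (path_graph n)) {} {}"
proof -
  obtain t where "forces (\<lambda>R' B'. contains_copy (path_graph k) R' \<or>
     (\<exists>ks. length ks = n \<and> distinct ks \<and> set ks \<subseteq> {0..} \<and> clique (set ks) B')) t {} {}"
    using forces_blue_clique[of k n] by blast
  then have "forces (target (path_graph k) (path_graph n)) t {} {}"
  proof (rule forces_weaken)
    fix R' B' :: "nat set set"
    assume "contains_copy (path_graph k) R' \<or>
     (\<exists>ks. length ks = n \<and> distinct ks \<and> set ks \<subseteq> {0..} \<and> clique (set ks) B')"
    moreover have "is_path B' ks" if "distinct ks" "clique (set ks) B'" for ks
      using that by (intro is_path_in_clique[of ks "set ks"]) (auto simp: clique_def)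
    ultimately show "target (path_graph k) (path_graph n) R' B'"
      by (auto simp: target_def contains_path_iff)
  qed
  then show ?thesis by (rule forces_online_ramsey)
qed

text \<open>Builder plays the game for \<open>P\<^sub>n\<close>, then the game for \<open>P\<^sub>m\<close> beyond all vertices of the blue path
  found first, and then joins the two blue paths.\<close>

lemma online_ramsey_path_join:
  assumes "k \<le> n" "k \<le> m"
  shows "online_ramsey (path_graph k) (path_graph (n + m - 2 * k)) \<le>
    online_ramsey (path_graph k) (path_graph n) + (online_ramsey (path_graph k) (path_graph m) + k * k)"
proof (rule online_ramsey_le, rule forces_then[OF forces_path_online_ramsey])
  fix R B assume "target (path_graph k) (path_graph n) R B"
  then consider "contains_copy (path_graph k) R" | xs where "length xs = n" "is_path B xs"
    by (auto simp: target_def contains_path_iff)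
  then show "forces (target (path_graph k) (path_graph (n + m - 2 * k)))
    (online_ramsey (path_graph k) (path_graph m) + k * k) R B"
  proof cases
    case 1
    then show ?thesis by (simp add: forces_now target_def)
  next
    case 2
    obtain N where N: "\<forall>x \<in> set xs. x < N"
      using finite_nat_set_iff_bounded by blast
    let ?Q = "\<lambda>R' B'. contains_copy (path_graph k) R' \<or>
      (\<exists>ys. length ys = m \<and> is_path B' ys \<and> set ys \<subseteq> {N..})"
    have inj: "inj ((+) N)" by simp
    have "forces ?Q (online_ramsey (path_graph k) (path_graph m))
        (R \<union> image ((+) N) ` {}) (B \<union> image ((+) N) ` {})"
    proof (rule forces_relabel[OF forces_path_online_ramsey inj])
      fix R1 B1 assume "target (path_graph k) (path_graph m) R1 B1"
      then consider zs where "length zs = k" "is_path R1 zs" | ys where "length ys = m" "is_path B1 ys"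
        by (auto simp: target_def contains_path_iff)
      then show "?Q (R \<union> image ((+) N) ` R1) (B \<union> image ((+) N) ` B1)"
      proof cases
        case 1
        from is_path_mono[OF is_path_relabel[OF 1(2) inj]]
        have "is_path (R \<union> image ((+) N) ` R1) (map ((+) N) zs)" by blast
        then show ?thesis using contains_path_of_long_path 1(1) by simp
      next
        case 2
        from is_path_mono[OF is_path_relabel[OF 2(2) inj]]
        have "is_path (B \<union> image ((+) N) ` B1) (map ((+) N) ys)" by blast
        then show ?thesis using 2(1)
          by (intro disjI2 exI[of _ "map ((+) N) ys"]) auto
      qed
    qed
    then have "forces ?Q (online_ramsey (path_graph k) (path_graph m)) R B" by simp
    then show ?thesis
    proof (rule forces_then)
      fix R' B' assume "B \<subseteq> B'" and "?Q R' B'"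
      then consider "contains_copy (path_graph k) R'"
        | ys where "length ys = m" "is_path B' ys" "set ys \<subseteq> {N..}" by blast
      then show "forces (target (path_graph k) (path_graph (n + m - 2 * k))) (k * k) R' B'"
      proof cases
        case 1
        then show ?thesis by (simp add: forces_now target_def)
      next
        case ys: 2
        have "set xs \<inter> set ys = {}" using N ys(3) by fastforce
        then show ?thesis
          using forces_joined_path[of B' xs k ys R'] 2 ys assms is_path_mono \<open>B \<subseteq> B'\<close> by blast
      qed
    qed
  qed
qed

section \<open>Closing a blue path to a cycle of prescribed length\<close>

text \<open>The cycle follows \<open>xs\<close> from \<open>a\<close> to \<open>b\<close>, enters the clique at \<open>d\<close>, and returns to \<open>a\<close> from \<open>c\<close>. The
  segment from \<open>a\<close> to \<open>b\<close> misses at most \<open>2k - 2\<close> vertices of \<open>xs\<close>, and this is exactly the number of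
  clique vertices other than \<open>c\<close> and \<open>d\<close>, so that the length can be adjusted to \<open>n + 2\<close>.\<close>

lemma contains_cycle_through_clique:
  assumes xs: "is_path B xs" "length xs = n" "2 * k \<le> n" "0 < k"
    and ks: "distinct ks" "length ks = 2 * k" "clique (set ks) B" "set xs \<inter> set ks = {}"
    and ac: "a \<in> set (take k xs)" "c \<in> set (take k ks)" "{a, c} \<in> B"
    and bd: "b \<in> set (drop (n - k) xs)" "d \<in> set (drop k ks)" "{b, d} \<in> B"
  shows "contains_copy (cycle_graph (n + 2)) B"
proof -
  obtain j where j: "j < k" "a = xs ! j"
    using ac(1) xs by (auto simp: in_set_conv_nth)
  obtain i where i: "i < n" "n \<le> i + k" "b = xs ! i"
  proof -
    obtain i' where "i' < k" "b = xs ! (n - k + i')"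
      using bd(1) xs by (auto simp: in_set_conv_nth)
    then show thesis using that[of "n - k + i'"] xs(3) by auto
  qed
  have "j < i" using i j xs by auto
  define vs where "vs = drop j (take (Suc i) xs)"
  have vs: "is_path B vs" "length vs = Suc i - j" "set vs \<subseteq> set xs" "vs \<noteq> []"
    using xs(1,2) i \<open>j < i\<close>
    by (auto simp: vs_def is_path_take is_path_drop dest: in_set_takeD in_set_dropD)
  have hd_vs: "hd vs = a"
    using xs(2) i j \<open>j < i\<close> by (simp add: vs_def hd_drop_conv_nth)
  have last_vs: "last vs = b"
    using xs(2) i \<open>j < i\<close> by (simp add: vs_def take_Suc_conv_app_nth)
  have cd: "c \<in> set ks" "d \<in> set ks" "c \<noteq> d"
    using ac(2) bd(2) ks(1) set_take_disj_set_drop_if_distinct[of ks k k]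
    by (auto dest: in_set_takeD in_set_dropD)
  define os where "os = take (n - length vs) (filter (\<lambda>u. u \<notin> {c, d}) ks)"
  have "length (filter (\<lambda>u. u \<notin> {c, d}) ks) = card (set ks - {c, d})"
    using ks(1) distinct_card[of "filter (\<lambda>u. u \<notin> {c, d}) ks"]
    by (simp add: set_diff_eq)
  also have "\<dots> = 2 * k - 2"
    using cd ks(1,2) by (simp add: card_Diff_subset distinct_card)
  finally have "length os = n - length vs"
    using i j vs(2) by (auto simp: os_def)
  then have len: "length (vs @ d # os @ [c]) = n + 2"
    using i vs(2) by auto
  have os: "distinct os" "set os \<subseteq> set ks - {c, d}"
    using ks(1) by (auto simp: os_def dest: in_set_takeD)
  then have "is_path B (d # os @ [c])"
    using cd ks(3) by (intro is_path_in_clique[of _ "set ks"]) (auto simp: clique_def)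
  then have "is_path B (vs @ d # os @ [c])"
    using vs last_vs bd(3) os(2) cd ks(4) by (auto simp: is_path_append_iff[of _ vs])
  then show ?thesis
    using contains_cycleI[OF _ len] ac(3) hd_vs vs(4) by (simp add: insert_commute)
qed

text \<open>The number of rounds needed to close a blue path is the same for all paths on at least \<open>2k\<close> vertices.\<close>

lemma forces_cycle_from_path:
  assumes "0 < k"
  shows "\<exists>t. \<forall>n \<ge> 2 * k. \<forall>R B. contains_copy (path_graph n) B \<longrightarrow>
    forces (target (path_graph k) (cycle_graph (n + 2))) t R B"
proof -
  let ?P = "\<lambda>a R' B'. contains_copy (path_graph k) R' \<or>
     (\<exists>ks. length ks = 2 * k \<and> distinct ks \<and> set ks \<subseteq> {a..} \<and> clique (set ks) B')"
  obtain t where t: "\<And>a R B. forces (?P a) t R B"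
    using forces_blue_clique[of k "2 * k"] by blast
  have "forces (target (path_graph k) (cycle_graph (n + 2))) (t + (k * k + k * k)) R B"
    if n: "2 * k \<le> n" and path: "contains_copy (path_graph n) B" for n R B
  proof -
    obtain xs where xs: "length xs = n" "is_path B xs" using path contains_path_iff by blast
    obtain N where N: "\<forall>x \<in> set xs. x < N"
      using finite_nat_set_iff_bounded by blast
    show ?thesis
    proof (rule forces_then[OF t[of N]])
      fix R1 B1 assume B1: "B \<subseteq> B1" and "?P N R1 B1"
      then consider "contains_copy (path_graph k) R1"
        | ks where "length ks = 2 * k" "distinct ks" "set ks \<subseteq> {N..}" "clique (set ks) B1" by blast
      then show "forces (target (path_graph k) (cycle_graph (n + 2))) (k * k + k * k) R1 B1"
      proof cases
        case 1
        then show ?thesis by (simp add: forces_now target_def)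
      next
        case ks: 2
        have disj: "set xs \<inter> set ks = {}" using N ks(3) by fastforce
        have "forces (\<lambda>R' B'. contains_copy (path_graph k) R' \<or>
            (\<exists>a \<in> set (take k xs). \<exists>c \<in> set (take k ks). {a, c} \<in> B')) (k * k) R1 B1"
          using xs ks n disj by (intro forces_blue_edge_between)
            (auto simp: is_path_def dest: in_set_takeD)
        then show ?thesis
        proof (rule forces_then)
          fix R2 B2 assume B2: "B1 \<subseteq> B2" and "contains_copy (path_graph k) R2 \<or>
            (\<exists>a \<in> set (take k xs). \<exists>c \<in> set (take k ks). {a, c} \<in> B2)"
          then consider "contains_copy (path_graph k) R2"
            | a c where "a \<in> set (take k xs)" "c \<in> set (take k ks)" "{a, c} \<in> B2" by blast
          then show "forces (target (path_graph k) (cycle_graph (n + 2))) (k * k) R2 B2"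
          proof cases
            case 1
            then show ?thesis by (simp add: forces_now target_def)
          next
            case ac: 2
            have "forces (\<lambda>R' B'. contains_copy (path_graph k) R' \<or>
                (\<exists>b \<in> set (drop (n - k) xs). \<exists>d \<in> set (drop k ks). {b, d} \<in> B')) (k * k) R2 B2"
              using xs ks n disj by (intro forces_blue_edge_between)
                (auto simp: is_path_def dest: in_set_dropD)
            then show ?thesis
            proof (rule forces_weaken)
              fix R3 B3 assume B3: "B2 \<subseteq> B3" and "contains_copy (path_graph k) R3 \<or>
                (\<exists>b \<in> set (drop (n - k) xs). \<exists>d \<in> set (drop k ks). {b, d} \<in> B3)"
              then consider "contains_copy (path_graph k) R3"
                | b d where "b \<in> set (drop (n - k) xs)" "d \<in> set (drop k ks)" "{b, d} \<in> B3"
                by blast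
              then show "target (path_graph k) (cycle_graph (n + 2)) R3 B3"
              proof cases
                case bd: 2
                have "is_path B3 xs" using is_path_mono xs(2) B1 B2 B3 by blast
                moreover have "clique (set ks) B3" using ks(4) B2 B3 unfolding clique_def by blast
                moreover have "{a, c} \<in> B3" using ac(3) B3 by blast
                ultimately show ?thesis
                  using contains_cycle_through_clique[of B3 xs n k ks a c b d]
                    xs(1) n assms ks(1,2) disj ac(1,2) bd by (simp add: target_def)
              qed (simp add: target_def)
            qed
          qed
        qed
      qed
    qed
  qed
  then show ?thesis by blast
qed

lemma online_ramsey_cycle_bounds:
  assumes "0 < k"
  shows "\<exists>t. \<forall>n \<ge> 2 * k.
    online_ramsey (path_graph k) (path_graph (n + 2)) \<le> online_ramsey (path_graph k) (cycle_graph (n + 2)) \<and>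
    online_ramsey (path_graph k) (cycle_graph (n + 2)) \<le> online_ramsey (path_graph k) (path_graph n) + t"
proof -
  obtain t where t: "\<And>n R B. 2 * k \<le> n \<Longrightarrow> contains_copy (path_graph n) B \<Longrightarrow>
      forces (target (path_graph k) (cycle_graph (n + 2))) t R B"
    using forces_cycle_from_path[OF assms] by blast
  have "online_ramsey (path_graph k) (path_graph (n + 2)) \<le> online_ramsey (path_graph k) (cycle_graph (n + 2)) \<and>
    online_ramsey (path_graph k) (cycle_graph (n + 2)) \<le> online_ramsey (path_graph k) (path_graph n) + t"
    if n: "2 * k \<le> n" for n
  proof -
    have up: "forces (target (path_graph k) (cycle_graph (n + 2)))
        (online_ramsey (path_graph k) (path_graph n) + t) {} {}"
    proof (rule forces_then[OF forces_path_online_ramsey])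
      fix R B assume "target (path_graph k) (path_graph n) R B"
      then show "forces (target (path_graph k) (cycle_graph (n + 2))) t R B"
        using t[OF n] by (auto simp: target_def intro: forces_now)
    qed
    have "forces (target (path_graph k) (path_graph (n + 2)))
        (online_ramsey (path_graph k) (cycle_graph (n + 2))) {} {}"
      using forces_online_ramsey[OF up]
      by (rule forces_weaken) (auto simp: target_def cycle_contains_path)
    then show ?thesis using up online_ramsey_le by blast
  qed
  then show ?thesis by blast
qed

section \<open>The linear lower bound\<close>

text \<open>Painter answers blue in every round.\<close>

lemma forces_against_blue:
  assumes "forces Q t R B" "finite B"
  shows "\<exists>B'. finite B' \<and> card B' \<le> card B + t \<and> Q R B'"
  using assms
proof (induction t arbitrary: B)
  case (Suc t)
  from Suc.prems(1) consider "Q R B" | e where "forces Q t R (insert e B)" by auto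
  then show ?case
  proof cases
    case 1
    then show ?thesis using Suc.prems(2) by (intro exI[of _ B]) simp
  next
    case 2
    then obtain B' where "finite B'" "card B' \<le> card (insert e B) + t" "Q R B'"
      using Suc.IH[of "insert e B"] Suc.prems(2) by auto
    moreover have "card (insert e B) \<le> Suc (card B)" by (rule card_insert_le_m1) auto
    ultimately show ?thesis by (intro exI[of _ B']) simp
  qed
qed auto

lemma online_ramsey_path_ge:
  assumes "2 \<le> k"
  shows "n \<le> online_ramsey (path_graph k) (path_graph n) + 1"
proof -
  obtain B where B: "finite B" "card B \<le> online_ramsey (path_graph k) (path_graph n)"
      "target (path_graph k) (path_graph n) {} B"
    using forces_against_blue[OF forces_path_online_ramsey[of k n]] by auto
  have "\<not> contains_copy (path_graph k) {}"
    using path_length_le_card[of k "{}"] assms by auto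
  then have "n - 1 \<le> card B" using B path_length_le_card by (auto simp: target_def)
  then show ?thesis using B(2) by simp
qed

section \<open>Limits\<close>

lemma subadditive_mult_add:
  fixes h :: "nat \<Rightarrow> nat"
  assumes "\<And>m n. h (m + n) \<le> h m + h n"
  shows "h (q * d + r) \<le> q * h d + h r"
proof (induction q)
  case (Suc q)
  have "h (Suc q * d + r) \<le> h d + h (q * d + r)"
    using assms[of d "q * d + r"] by (simp add: add.assoc)
  with Suc show ?case by simp
qed simp

text \<open>Fekete's subadditive lemma: the limit is the infimum. If \<open>d\<close> is such that \<open>h d / d\<close> is close to the
  infimum, division of \<open>n\<close> by \<open>d\<close> with remainder bounds \<open>h n / n\<close> by \<open>h d / d\<close> plus a term that
  vanishes as \<open>n\<close> grows.\<close>

lemma fekete: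
  fixes h :: "nat \<Rightarrow> nat"
  assumes sub: "\<And>m n. h (m + n) \<le> h m + h n"
  shows "\<exists>L::real. (\<lambda>n. real (h n) / real n) \<longlonglongrightarrow> L"
proof -
  let ?S = "(\<lambda>n. real (h n) / real n) ` {1..}"
  have bdd: "bdd_below ?S" by (rule bdd_belowI[of _ 0]) auto
  have "(\<lambda>n. real (h n) / real n) \<longlonglongrightarrow> Inf ?S"
  proof (rule LIMSEQ_I)
    fix \<epsilon> :: real assume \<epsilon>: "0 < \<epsilon>"
    have "\<exists>x \<in> ?S. x < Inf ?S + \<epsilon> / 2"
      using \<epsilon> by (intro cInf_lessD) auto
    then obtain d where d: "1 \<le> d" "real (h d) / real d < Inf ?S + \<epsilon> / 2" by auto
    define C where "C = Max (h ` {..<d})"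
    obtain M where M: "2 * real C / \<epsilon> < real M" using reals_Archimedean2 by blast
    have "norm (real (h n) / real n - Inf ?S) < \<epsilon>" if n: "Suc M \<le> n" for n
    proof -
      have "h (n mod d) \<le> C" unfolding C_def using d(1) by (intro Max_ge) auto
      then have "h n \<le> (n div d) * h d + C"
        using subadditive_mult_add[OF sub, of "n div d" d "n mod d"] by simp
      then have "real (h n) \<le> real (n div d) * real (h d) + real C"
        by (metis of_nat_add of_nat_le_iff of_nat_mult)
      also have "real (n div d) * real (h d) \<le> (real n / real d) * real (h d)"
        by (intro mult_right_mono of_nat_div_le_of_nat) simp
      finally have "real (h n) / real n \<le> real (h d) / real d + real C / real n"
        using n d(1) by (simp add: field_simps)
      moreover have "real C / real n < \<epsilon> / 2"
      proof -
        have "2 * real C / \<epsilon> < real n" using M n by simp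
        then show ?thesis using \<epsilon> n by (simp add: field_simps)
      qed
      moreover have "Inf ?S \<le> real (h n) / real n"
        using n by (intro cInf_lower bdd) auto
      ultimately show ?thesis using d(2) unfolding real_norm_def by linarith
    qed
    then show "\<exists>no. \<forall>n \<ge> no. norm (real (h n) / real n - Inf ?S) < \<epsilon>" by blast
  qed
  then show ?thesis by blast
qed

text \<open>Bounded additive errors, in the value or in the argument, do not affect linear growth rates.\<close>

lemma tendsto_ratio_shift:
  fixes g :: "nat \<Rightarrow> real"
  assumes "(\<lambda>n. g n / real n) \<longlonglongrightarrow> L"
  shows "(\<lambda>n. (g n + c) / real (n + s)) \<longlonglongrightarrow> L"
proof -
  have "(\<lambda>n. (g n / real n + c / real n) / (1 + real s / real n)) \<longlonglongrightarrow> (L + 0) / (1 + 0)"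
    by (intro tendsto_intros assms lim_const_over_n) simp
  moreover have "\<forall>\<^sub>F n in sequentially.
      (g n / real n + c / real n) / (1 + real s / real n) = (g n + c) / real (n + s)"
    using eventually_gt_at_top[of 0]
  proof eventually_elim
    case (elim n)
    then have "1 + real s / real n = real (n + s) / real n" by (simp add: field_simps)
    moreover have "g n / real n + c / real n = (g n + c) / real n"
      by (simp add: add_divide_distrib)
    ultimately show ?case using elim by simp
  qed
  ultimately show ?thesis by (simp add: filterlim_cong)
qed

lemma online_ramsey_path_limit:
  "\<exists>L::real. (\<lambda>n. real (online_ramsey (path_graph k) (path_graph n)) / real n) \<longlonglongrightarrow> L"
proof -
  let ?f = "\<lambda>n. online_ramsey (path_graph k) (path_graph n)"
  \<comment> \<open>Shifting the argument absorbs the \<open>2k\<close> vertices lost in a join, the summand \<open>k\<^sup>2\<close> its cost.\<close>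
  define h where "h n = ?f (n + 2 * k) + k * k" for n
  have "h (m + n) \<le> h m + h n" for m n
    using online_ramsey_path_join[of k "m + 2 * k" "n + 2 * k"]
    by (simp add: h_def algebra_simps)
  then obtain L where "(\<lambda>n. real (h n) / real n) \<longlonglongrightarrow> L" using fekete by blast
  from tendsto_ratio_shift[OF this, of "- real (k * k)" "2 * k"]
  have "(\<lambda>n. real (?f (n + 2 * k)) / real (n + 2 * k)) \<longlonglongrightarrow> L" by (simp add: h_def)
  then have "(\<lambda>n. real (?f n) / real n) \<longlonglongrightarrow> L" by (rule LIMSEQ_offset)
  then show ?thesis by blast
qed

theorem theorem1p3:
  fixes k :: nat
  assumes "k \<ge> 1"
  shows "\<exists>L::real. (k \<noteq> 1 \<longrightarrow> L > 0) \<and>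
    (\<lambda>n. real (online_ramsey (path_graph k) (path_graph n)) / real n) \<longlonglongrightarrow> L \<and>
    (\<lambda>n. real (online_ramsey (path_graph k) (cycle_graph n)) / real n) \<longlonglongrightarrow> L"
proof -
  let ?f = "\<lambda>n. online_ramsey (path_graph k) (path_graph n)"
  let ?g = "\<lambda>n. online_ramsey (path_graph k) (cycle_graph n)"
  obtain L :: real where L: "(\<lambda>n. real (?f n) / real n) \<longlonglongrightarrow> L"
    using online_ramsey_path_limit by blast
  have pos: "1 \<le> L" if "k \<noteq> 1"
  proof (rule LIMSEQ_le_const[OF tendsto_ratio_shift[OF L, of 1 0]])
    have "1 \<le> (real (?f n) + 1) / real (n + 0)" if "1 \<le> n" for n
      using online_ramsey_path_ge[of k n] \<open>k \<noteq> 1\<close> assms that by simp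
    then show "\<exists>N. \<forall>n \<ge> N. 1 \<le> (real (?f n) + 1) / real (n + 0)" by blast
  qed
  obtain t where t: "\<And>n. 2 * k \<le> n \<Longrightarrow> ?f (n + 2) \<le> ?g (n + 2) \<and> ?g (n + 2) \<le> ?f n + t"
    using online_ramsey_cycle_bounds[of k] assms by auto
  have "(\<lambda>n. real (?g (n + 2)) / real (n + 2)) \<longlonglongrightarrow> L"
  proof (rule tendsto_sandwich)
    show "(\<lambda>n. real (?f (n + 2)) / real (n + 2)) \<longlonglongrightarrow> L"
      using L by (rule LIMSEQ_ignore_initial_segment)
    show "(\<lambda>n. (real (?f n) + real t) / real (n + 2)) \<longlonglongrightarrow> L"
      using L by (rule tendsto_ratio_shift)
    show "\<forall>\<^sub>F n in sequentially. real (?f (n + 2)) / real (n + 2) \<le> real (?g (n + 2)) / real (n + 2)"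
      using eventually_ge_at_top[of "2 * k"]
      by eventually_elim (use t in \<open>auto intro!: divide_right_mono\<close>)
    show "\<forall>\<^sub>F n in sequentially. real (?g (n + 2)) / real (n + 2) \<le> (real (?f n) + real t) / real (n + 2)"
      using eventually_ge_at_top[of "2 * k"]
    proof eventually_elim
      case (elim n)
      then have "real (?g (n + 2)) \<le> real (?f n) + real t" using t[of n] by linarith
      then show ?case by (intro divide_right_mono) auto
    qed
  qed
  then have "(\<lambda>n. real (?g n) / real n) \<longlonglongrightarrow> L" by (rule LIMSEQ_offset)
  with L pos show ?thesis by force
qed

end
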